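(* Let $n$ be a positive integer, let $g\in\mathbb{C}$ be a constant, and suppose that $u$ is an entire function on $\mathbb{C}^n$ satisfying $$u_{z_1}u_{z_2}\cdots u_{z_n}=e^{g}$$ on $\mathbb{C}^n$. Then $u$ is a linear function.
   Context: An entire function on $\mathbb{C}^n$ is a holomorphic function $u:\mathbb{C}^n\to\mathbb{C}$ of $z=(z_1,\dots,z_n)$, and $u_{z_j}=\partial u/\partial z_j$ denotes the complex partial derivative. "Linear function" means a function of the form $c_0+c_1z_1+\cdots+c_nz_n$ with complex constants $c_0,\dots,c_n$ (a constant term is allowed). *)

theory Defs
  imports "HOL-Analysis.Analysis"
begin

(* Several complex variables: the real Frechet derivative exists at every point and is
   complex linear. *)
definition entire :: "(complex ^ 'n \<Rightarrow> complex) \<Rightarrow> bool" where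
  "entire u \<longleftrightarrow>
     (\<forall>z. \<exists>L. Vector_Spaces.linear (*s) (*) L \<and> (u has_derivative L) (at z))"

definition partial_deriv :: "'n \<Rightarrow> (complex ^ 'n \<Rightarrow> complex) \<Rightarrow> complex ^ 'n \<Rightarrow> complex" where
  "partial_deriv j u z = deriv (\<lambda>w. u (\<chi> i. if i = j then w else z $ i)) (z $ j)"

(* A constant term is allowed. *)
definition linear_function :: "(complex ^ 'n \<Rightarrow> complex) \<Rightarrow> bool" where
  "linear_function u \<longleftrightarrow>
     (\<exists>(c0 :: complex) (c :: complex ^ 'n). \<forall>z. u z = c0 + (\<Sum>j\<in>UNIV. c $ j * z $ j))"

end

theory Submission
  imports Defs "HOL-Complex_Analysis.Conformal_Mappings" "HOL-Real_Asymp.Real_Asymp"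
begin

text \<open>
  Write \<open>p\<^sub>j\<close> for the partial derivatives of \<open>u\<close>. They are entire and, their product being a nonzero
  constant, they have no zeros. The proof plays two facts about them against each other.

  First, the logarithmic derivatives of a zero-free function grow at most as fast as the logarithm
  of its modulus: if \<open>\<bar>ln \<bar>p\<^sub>j\<bar>\<bar> \<le> N\<close> on a ball of radius \<open>s\<close>, then \<open>\<partial>\<^sub>k p\<^sub>j / p\<^sub>j\<close> is at most \<open>8 N / s\<close>
  at the centre (\<open>logarithmic_derivative_bound\<close>).

  Second, mixed partial derivatives commute, \<open>\<partial>\<^sub>k p\<^sub>j = \<partial>\<^sub>j p\<^sub>k\<close>. Hence \<open>b = \<partial>\<^sub>k p\<^sub>j / p\<^sub>j\<close> satisfies
  \<open>b \<cdot> (p\<^sub>j / p\<^sub>k) = \<partial>\<^sub>j p\<^sub>k / p\<^sub>k\<close>, so the zero-free function \<open>p\<^sub>j / p\<^sub>k\<close> is a quotient of two logarithmic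
  derivatives, unless these vanish identically. A quotient of two functions of size \<open>K\<close> that happens to
  have neither zeros nor poles is bounded on a smaller disc by a power of \<open>K\<close>, up to a factor that depends
  on the denominator at the centre (\<open>nonvanishing_quotient_bound\<close>). So \<open>ln \<bar>p\<^sub>j / p\<^sub>k\<bar>\<close> is only of the order of \<open>ln N\<close>
  when the individual \<open>ln \<bar>p\<^sub>i\<bar>\<close> are of the order of \<open>N\<close> on a slightly larger ball
  (\<open>ratio_of_partials_bound\<close>).

  It remains to return from the ratios to the functions themselves. Join \<open>j\<close> and \<open>k\<close> by an edge if
  \<open>\<partial>\<^sub>k p\<^sub>j\<close> is not identically zero. Along the paths of this graph all \<open>ln \<bar>p\<^sub>j\<bar>\<close> of one connected
  component differ by terms of order \<open>ln N\<close>. Their sum over a component is constant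
  (\<open>component_product_constant\<close>), because \<open>u\<close> splits into a sum of functions of
  separate groups of variables, one group for each component. So the \<open>ln \<bar>p\<^sub>j\<bar>\<close> themselves are of order
  \<open>ln N\<close>. A nondecreasing function \<open>M\<close> with \<open>M(r)\<close> of the order of \<open>ln M(r')\<close>, for \<open>r'\<close> slightly larger
  than \<open>r\<close>, is bounded (\<open>bounded_if_self_improving\<close>), so the \<open>p\<^sub>j\<close> are bounded, and Liouville's theorem
  makes them constant.
\<close>

section \<open>Zero-free functions and their quotients in one complex variable\<close>

text \<open>The map \<open>w \<mapsto> w / (2 B - w)\<close> sends the half-plane \<open>Re w < B\<close> into the unit disc and fixes \<open>0\<close>, so
  the Schwarz lemma applies to its composition with \<open>f\<close>. The strict inequality needed there forces
  \<open>B > A\<close>; the stated bound is the limit \<open>B \<rightarrow> A\<close>.\<close>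
lemma Borel_Caratheodory:
  fixes f :: "complex \<Rightarrow> complex"
  assumes holf: "f holomorphic_on ball 0 R" and f0: "f 0 = 0"
    and ReA: "\<And>w. norm w < R \<Longrightarrow> Re (f w) \<le> A" and z: "norm z < R"
  shows "norm (f z) \<le> 2 * A * norm z / (R - norm z)"
proof -
  have R: "R > 0" using z norm_ge_zero[of z] by linarith
  have A0: "A \<ge> 0" using ReA[of 0] R f0 by simp
  have strict: "norm (f z) * (R - norm z) \<le> 2 * B * norm z" if B: "B > A" for B
  proof -
    have B0: "B > 0" using B A0 by simp
    have less: "norm (f w) < norm (2 * of_real B - f w)" if "norm w < R" for w
    proof -
      have "(norm (2 * of_real B - f w))\<^sup>2 - (norm (f w))\<^sup>2 = 4 * B * (B - Re (f w))"
        unfolding cmod_power2 by (simp add: algebra_simps power2_eq_square)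
      moreover have "4 * B * (B - Re (f w)) > 0"
        using ReA[OF that] B B0 by (intro mult_pos_pos) auto
      ultimately have "(norm (f w))\<^sup>2 < (norm (2 * of_real B - f w))\<^sup>2" by linarith
      then show ?thesis by (rule power_less_imp_less_base) simp
    qed
    define g where "g = (\<lambda>w. f (of_real R * w) / (2 * of_real B - f (of_real R * w)))"
    have sc: "norm (of_real R * w) < R" if "norm w < 1" for w :: complex
      using that R by (simp add: norm_mult)
    have den: "2 * of_real B - f w \<noteq> 0" if "norm w < R" for w
      using less[OF that] by fastforce
    have holg: "g holomorphic_on ball 0 1"
      unfolding g_def
    proof (intro holomorphic_intros)
      have *: "(f \<circ> (\<lambda>w. of_real R * w)) holomorphic_on ball 0 1"
        by (rule holomorphic_on_compose_gen[OF _ holf]) (use sc in \<open>auto intro!: holomorphic_intros\<close>)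
      show "(\<lambda>w. f (of_real R * w)) holomorphic_on ball 0 1"
        "(\<lambda>w. f (of_real R * w)) holomorphic_on ball 0 1"
        using * by (simp_all add: o_def)
    qed (use den sc in auto)
    have gl: "norm (g w) < 1" if "norm w < 1" for w
      using less[OF sc[OF that]] den[OF sc[OF that]] unfolding g_def
      by (simp add: norm_divide divide_less_eq)
    define w where "w = z / of_real R"
    have w: "norm w < 1" "of_real R * w = z" using z R by (auto simp: w_def norm_divide)
    have "norm (g w) \<le> norm w"
      by (rule Schwarz_Lemma(1)[OF holg _ gl w(1)]) (simp_all add: g_def f0)
    then have "norm (f z) \<le> norm w * norm (2 * of_real B - f z)"
      using den[OF z] unfolding g_def w(2) by (simp add: norm_divide divide_le_eq)
    also have "\<dots> \<le> norm w * (2 * B + norm (f z))"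
      by (rule mult_left_mono) (use norm_triangle_ineq4[of "2 * of_real B" "f z"] B0 in \<open>simp_all add: norm_mult\<close>)
    finally have "R * norm (f z) \<le> R * (norm w * (2 * B + norm (f z)))"
      using R by simp
    also have "\<dots> = norm z * (2 * B + norm (f z))"
      using R by (simp add: w_def norm_divide)
    finally show ?thesis by (simp add: algebra_simps)
  qed
  have "norm (f z) * (R - norm z) \<le> 2 * A * norm z"
  proof (rule field_le_epsilon)
    fix e :: real assume e: "e > 0"
    have "norm (f z) * (R - norm z) \<le> 2 * (A + e / (2 * R)) * norm z"
      by (rule strict) (use e R in simp)
    also have "\<dots> = 2 * A * norm z + e * (norm z / R)" using R by (simp add: field_simps)
    also have "\<dots> \<le> 2 * A * norm z + e"
      using mult_left_mono[of "norm z / R" 1 e] e z R by simp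
    finally show "norm (f z) * (R - norm z) \<le> 2 * A * norm z + e" .
  qed
  then show ?thesis using z by (simp add: le_divide_eq)
qed

lemma normalized_logarithm:
  fixes p :: "complex \<Rightarrow> complex"
  assumes hol: "p holomorphic_on ball 0 R" and nz: "\<And>w. norm w < R \<Longrightarrow> p w \<noteq> 0" and R: "R > 0"
  obtains f where "f holomorphic_on ball 0 R" "f 0 = 0"
    "\<And>w. norm w < R \<Longrightarrow> p w = p 0 * exp (f w)"
    "\<And>w. norm w < R \<Longrightarrow> Re (f w) = ln (norm (p w)) - ln (norm (p 0))"
proof -
  obtain h where h: "h holomorphic_on ball 0 R" "\<And>w. w \<in> ball 0 R \<Longrightarrow> exp (h w) = p w"
    by (rule holomorphic_logarithm_exists[OF _ _ hol, of 0]) (use nz R in auto)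
  have ex: "p w = p 0 * exp (h w - h 0)" if "norm w < R" for w
    using h(2)[of w] h(2)[of 0] that R by (simp add: exp_diff nz field_simps)
  show thesis
  proof (rule that[of "\<lambda>w. h w - h 0"])
    fix w :: complex assume w: "norm w < R"
    have "norm (p w) = exp (Re (h w))" "norm (p 0) = exp (Re (h 0))"
      using h(2)[of w] h(2)[of 0] w R by (simp_all flip: norm_exp_eq_Re)
    then show "Re (h w - h 0) = ln (norm (p w)) - ln (norm (p 0))" by simp
  qed (use h ex in \<open>auto intro!: holomorphic_intros\<close>)
qed

text \<open>The normalised logarithm of \<open>p\<close> vanishes at \<open>0\<close> and has real part at most \<open>2 M\<close>. The
  Borel-Caratheodory inequality bounds its modulus by \<open>4 M\<close> on the circle of radius \<open>s / 2\<close>, and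
  Cauchy's inequality then bounds its derivative at \<open>0\<close>, which is \<open>p'(0) / p(0)\<close>.\<close>
lemma logarithmic_derivative_bound:
  fixes p :: "complex \<Rightarrow> complex"
  assumes hol: "p holomorphic_on ball 0 s" and nz: "\<And>w. norm w < s \<Longrightarrow> p w \<noteq> 0" and s: "s > 0"
    and M: "\<And>w. norm w < s \<Longrightarrow> \<bar>ln (norm (p w))\<bar> \<le> M"
  shows "norm (deriv p 0 / p 0) \<le> 8 * M / s"
proof -
  obtain f where f: "f holomorphic_on ball 0 s" "f 0 = 0"
    "\<And>w. norm w < s \<Longrightarrow> p w = p 0 * exp (f w)"
    "\<And>w. norm w < s \<Longrightarrow> Re (f w) = ln (norm (p w)) - ln (norm (p 0))"
    using normalized_logarithm[OF hol nz s] by metis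
  have Re: "Re (f w) \<le> 2 * M" if "norm w < s" for w
    using f(4)[OF that] M[OF that] M[of 0] s by (simp add: abs_le_iff)
  have bd: "norm (f w) \<le> 4 * M" if "norm (0 - w) = s / 2" for w
  proof -
    have w: "norm w = s / 2" using that by simp
    show ?thesis
      using Borel_Caratheodory[OF f(1,2) Re, of w] s unfolding w by (simp add: field_simps)
  qed
  have "norm ((deriv ^^ 1) f 0) \<le> fact 1 * (4 * M) / (s / 2) ^ 1"
  proof (rule Cauchy_inequality[OF _ _ _ bd])
    show "f holomorphic_on ball 0 (s / 2)"
      by (rule holomorphic_on_subset[OF f(1)]) (use s in auto)
    show "continuous_on (cball 0 (s / 2)) f"
      by (rule continuous_on_subset[OF holomorphic_on_imp_continuous_on[OF f(1)]]) (use s in auto)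
  qed (use s in auto)
  then have df: "norm (deriv f 0) \<le> 8 * M / s" by simp
  have "(f has_field_derivative deriv f 0) (at 0)"
    by (rule holomorphic_derivI[OF f(1)]) (use s in auto)
  then have "((\<lambda>w. p 0 * exp (f w)) has_field_derivative p 0 * deriv f 0) (at 0)"
    by (auto intro!: derivative_eq_intros simp: f(2))
  then have "(p has_field_derivative p 0 * deriv f 0) (at 0)"
    by (rule has_field_derivative_transform_within_open[of _ _ _ "ball 0 s"])
       (use s in \<open>auto simp flip: f(3)\<close>)
  then have "deriv p 0 = p 0 * deriv f 0" by (rule DERIV_imp_deriv)
  then show ?thesis using df nz[of 0] s by simp
qed

lemma maximum_modulus_disc:
  fixes f :: "complex \<Rightarrow> complex"
  assumes "f holomorphic_on UNIV" "\<And>w. norm w = R \<Longrightarrow> norm (f w) \<le> K" "norm z \<le> R" "R > 0"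
  shows "norm (f z) \<le> K"
proof (rule maximum_modulus_frontier[of f "cball 0 R"])
  show "f holomorphic_on interior (cball 0 R)"
    by (rule holomorphic_on_subset[OF assms(1)]) simp
  show "continuous_on (closure (cball 0 R)) f"
    by (rule continuous_on_subset[OF holomorphic_on_imp_continuous_on[OF assms(1)]]) simp
qed (use assms in auto)

text \<open>A zero \<open>a\<close> is removed by dividing by the Blaschke factor \<open>R (w - a) / (R\<^sup>2 - cnj a \<cdot> w)\<close>, which has
  modulus \<open>1\<close> on the circle of radius \<open>R\<close>. Each removal multiplies the modulus at the origin by at
  least \<open>R / \<rho>\<close>, while the maximum principle keeps it below \<open>K\<close>. So fewer than \<open>N\<close> removals are
  possible, and the induction on \<open>N\<close> needs no count of the zeros.\<close>
lemma divide_out_zeros: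
  fixes b :: "complex \<Rightarrow> complex"
  assumes "b holomorphic_on UNIV" "b 0 \<noteq> 0" "\<And>w. norm w = R \<Longrightarrow> norm (b w) \<le> K"
    and \<rho>: "0 < \<rho>" "\<rho> < R" and "K < norm (b 0) * (R / \<rho>) ^ N"
  shows "\<exists>c. c holomorphic_on UNIV \<and> (\<forall>w. norm w \<le> \<rho> \<longrightarrow> c w \<noteq> 0) \<and>
    (\<forall>w. norm w = R \<longrightarrow> norm (c w) = norm (b w)) \<and> norm (b 0) \<le> norm (c 0)"
  using assms(1,2,3,6)
proof (induction N arbitrary: b)
  case 0
  have "norm (b 0) \<le> K"
    by (rule maximum_modulus_disc[of b R]) (use 0 \<rho> in auto)
  with 0 show ?case by simp
next
  case (Suc N)
  show ?case
  proof (cases "\<exists>a. norm a \<le> \<rho> \<and> b a = 0")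
    case False
    with Suc.prems show ?thesis by auto
  next
    case True
    then obtain a where a: "norm a \<le> \<rho>" "b a = 0" by blast
    have a0: "a \<noteq> 0" using a Suc.prems by auto
    define d where "d = (\<lambda>w. (if w = a then deriv b a else (b w - b a) / (w - a)) *
        ((of_real R)\<^sup>2 - cnj a * w) / of_real R)"
    have hold: "d holomorphic_on UNIV"
      unfolding d_def using pole_lemma_open[OF Suc.prems(1) open_UNIV, of a] \<rho>
      by (intro holomorphic_intros) auto
    have d_circle: "norm (d w) = norm (b w)" if w: "norm w = R" for w
    proof -
      have wa: "w \<noteq> a" using w a \<rho> by auto
      have "(of_real R)\<^sup>2 = w * cnj w" using w complex_norm_square[of w] by simp
      then have "(of_real R)\<^sup>2 - cnj a * w = w * cnj (w - a)" by (simp add: algebra_simps)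
      then have "norm ((of_real R)\<^sup>2 - cnj a * w) = R * norm (w - a)"
        using w by (simp add: norm_mult complex_mod_cnj del: complex_cnj_diff)
      then show ?thesis using wa a \<rho> by (simp add: d_def norm_mult norm_divide)
    qed
    have d_0: "norm (d 0) = norm (b 0) * (R / norm a)"
      using a a0 \<rho> by (simp add: d_def norm_mult norm_divide power2_eq_square)
    have le: "R / \<rho> \<le> R / norm a" using a a0 \<rho> by (intro divide_left_mono) auto
    have "norm (b 0) * (R / \<rho>) * (R / \<rho>) ^ N \<le> norm (d 0) * (R / \<rho>) ^ N"
      unfolding d_0 using le \<rho> by (intro mult_right_mono mult_left_mono) auto
    then have K: "K < norm (d 0) * (R / \<rho>) ^ N" using Suc.prems(4) by (simp add: mult.assoc)
    have "1 \<le> R / norm a" using le \<rho> by (smt (verit) le_divide_eq_1_pos)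
    then have b0: "norm (b 0) \<le> norm (d 0)" unfolding d_0 using mult_left_mono[of 1 "R / norm a" "norm (b 0)"] by simp
    obtain c where "c holomorphic_on UNIV" "\<forall>w. norm w \<le> \<rho> \<longrightarrow> c w \<noteq> 0"
      "\<forall>w. norm w = R \<longrightarrow> norm (c w) = norm (d w)" "norm (d 0) \<le> norm (c 0)"
      using Suc.IH[OF hold _ _ K] b0 Suc.prems d_circle by force
    then show ?thesis using d_circle b0 by (intro exI[of _ c]) auto
  qed
qed

text \<open>This bounds the zero-free quotient \<open>q = (b q) / b\<close> by the sizes of its numerator and denominator.
  Since \<open>q\<close> has no zeros, dividing \<open>b\<close> by its zeros in a disc also divides \<open>b q\<close> by its zeros there,
  and the bound \<open>K\<close> survives both divisions. The denominator left over, \<open>c\<close>, has a logarithm, and its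
  smallness is controlled through the value at the origin by the Borel-Caratheodory inequality.\<close>
lemma nonvanishing_quotient_bound:
  fixes b q :: "complex \<Rightarrow> complex"
  assumes holb: "b holomorphic_on UNIV" and holq: "q holomorphic_on UNIV" and q: "\<And>w. q w \<noteq> 0"
    and b0: "b 0 \<noteq> 0"
    and K: "\<And>w. norm w = R \<Longrightarrow> norm (b w) \<le> K" "\<And>w. norm w = R \<Longrightarrow> norm (b w * q w) \<le> K"
    and r: "norm z \<le> r" "r < \<rho>" "\<rho> < R"
  shows "ln (norm (q z)) \<le> (1 + 2 * r / (\<rho> - r)) * ln (K / norm (b 0))"
proof -
  have \<rho>: "0 < \<rho>" "0 < R" using r norm_ge_zero[of z] by linarith+
  have "R / \<rho> > 1" using r \<rho> by simp
  then obtain N where "K / norm (b 0) < (R / \<rho>) ^ N"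
    using real_arch_pow by blast
  then have "K < norm (b 0) * (R / \<rho>) ^ N" using b0 by (simp add: divide_less_eq mult.commute)
  then obtain c where c: "c holomorphic_on UNIV" "\<And>w. norm w \<le> \<rho> \<Longrightarrow> c w \<noteq> 0"
    "\<And>w. norm w = R \<Longrightarrow> norm (c w) = norm (b w)" "norm (b 0) \<le> norm (c 0)"
    using divide_out_zeros[OF holb b0 K(1) \<rho>(1) r(3)] by blast
  have cK: "norm (c w) \<le> K" if "norm w \<le> R" for w
    by (rule maximum_modulus_disc[OF c(1) _ that \<rho>(2)]) (simp add: c(3) K(1))
  have cqK: "norm (c w * q w) \<le> K" if "norm w \<le> R" for w
    by (rule maximum_modulus_disc[OF _ _ that \<rho>(2)])
       (use c(1,3) holq K(2) in \<open>auto intro!: holomorphic_intros simp: norm_mult\<close>)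
  define A where "A = ln (K / norm (c 0))"
  have K0: "K > 0" using cK[of 0] c(2)[of 0] \<rho> by (smt (verit) norm_zero zero_less_norm_iff)
  have c0: "norm (c 0) > 0" using c(2)[of 0] \<rho> by simp
  have "c holomorphic_on ball 0 \<rho>" using c(1) by (rule holomorphic_on_subset) simp
  then obtain f where f: "f holomorphic_on ball 0 \<rho>" "f 0 = 0"
    "\<And>w. norm w < \<rho> \<Longrightarrow> c w = c 0 * exp (f w)"
    "\<And>w. norm w < \<rho> \<Longrightarrow> Re (f w) = ln (norm (c w)) - ln (norm (c 0))"
    using normalized_logarithm[of c \<rho>] c(2) \<rho>(1) by (metis less_imp_le)
  have Re: "Re (f w) \<le> A" if "norm w < \<rho>" for w
    using f(4)[OF that] cK[of w] c(2)[of w] that r(3) K0 c0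
    by (simp add: A_def ln_div)
  have A0: "A \<ge> 0" using Re[of 0] f(2) \<rho> by simp
  have zr: "norm z < \<rho>" using r by simp
  have "norm (f z) \<le> 2 * A * norm z / (\<rho> - norm z)"
    by (rule Borel_Caratheodory[OF f(1,2) Re zr])
  also have "\<dots> \<le> 2 * A * r / (\<rho> - r)"
    by (rule frac_le) (use A0 r norm_ge_zero[of z] in \<open>auto intro!: mult_left_mono mult_nonneg_nonneg simp del: norm_ge_zero\<close>)
  finally have fz: "norm (f z) \<le> 2 * r / (\<rho> - r) * A" by (simp add: mult_ac)
  have "ln (norm (c z)) + ln (norm (q z)) \<le> ln K"
    using ln_mono[OF cqK[of z]] r c(2)[of z] q[of z] by (simp add: norm_mult ln_mult)
  moreover have "ln (norm (c z)) \<ge> ln (norm (c 0)) - norm (f z)"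
    using f(4)[OF zr] abs_Re_le_cmod[of "f z"] by linarith
  ultimately have "ln (norm (q z)) \<le> A + norm (f z)"
    using K0 c0 by (simp add: A_def ln_div)
  also have "\<dots> \<le> (1 + 2 * r / (\<rho> - r)) * A" using fz by (simp add: algebra_simps)
  also have "\<dots> \<le> (1 + 2 * r / (\<rho> - r)) * ln (K / norm (b 0))"
  proof (rule mult_left_mono)
    show "A \<le> ln (K / norm (b 0))" unfolding A_def
      using K0 c0 b0 c(4) by (intro ln_mono divide_left_mono) auto
    show "0 \<le> 1 + 2 * r / (\<rho> - r)" using r norm_ge_zero[of z] by (intro add_nonneg_nonneg divide_nonneg_pos) linarith+
  qed
  finally show ?thesis .
qed

section \<open>Functions holomorphic on complex lines\<close>

lemma norm_scalar_vector_mult: "norm (t *s v) = norm t * norm v"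
  for t :: complex and v :: "complex ^ 'n"
  by (simp add: norm_vec_def norm_mult L2_set_right_distrib)

text \<open>Osgood's form of holomorphy in several variables. Unlike complex Frechet differentiability, it
  is visibly inherited by locally uniform limits and reduces to statements in one variable.\<close>
definition line_holomorphic :: "(complex ^ 'n \<Rightarrow> complex) \<Rightarrow> bool" where
  "line_holomorphic f \<longleftrightarrow>
     continuous_on UNIV f \<and> (\<forall>a v. (\<lambda>t. f (a + t *s v)) holomorphic_on UNIV)"

definition dir_deriv :: "complex ^ 'n \<Rightarrow> (complex ^ 'n \<Rightarrow> complex) \<Rightarrow> complex ^ 'n \<Rightarrow> complex" where
  "dir_deriv v f z = deriv (\<lambda>t. f (z + t *s v)) 0"

lemma line_holomorphicD:
  assumes "line_holomorphic f"
  shows "continuous_on A f" "(\<lambda>t. f (a + t *s v)) holomorphic_on B"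
  using assms unfolding line_holomorphic_def
  by (meson continuous_on_subset holomorphic_on_subset subset_UNIV)+


lemma has_derivative_line:
  fixes u :: "complex ^ 'n \<Rightarrow> complex"
  assumes "(u has_derivative L) (at (a + s *s v))" "Vector_Spaces.linear (*s) (*) L"
  shows "((\<lambda>t. u (a + t *s v)) has_field_derivative L v) (at s)"
proof -
  have bl: "bounded_linear (\<lambda>t. t *s v)"
    by (rule bounded_linear_intro[of _ "norm v"])
       (auto simp: vector_sadd_rdistrib norm_scalar_vector_mult vec_eq_iff algebra_simps)
  have "((\<lambda>t. a + t *s v) has_derivative (\<lambda>t. t *s v)) (at s)"
    by (auto intro!: derivative_eq_intros bounded_linear_imp_has_derivative[OF bl])
  from has_derivative_compose[OF this assms(1)]
  have "((\<lambda>t. u (a + t *s v)) has_derivative (\<lambda>t. L (t *s v))) (at s)" .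
  moreover have "L (t *s v) = L v * t" for t
    using module_hom.scale[OF Vector_Spaces.linear.axioms(3)[OF assms(2)], of t v] by (simp add: mult.commute)
  ultimately show ?thesis by (simp add: has_field_derivative_def)
qed

lemma entire_imp_line_holomorphic:
  assumes "entire u" shows "line_holomorphic u"
  unfolding line_holomorphic_def
proof (intro conjI allI)
  show "continuous_on UNIV u"
    using assms unfolding entire_def
    by (intro continuous_at_imp_continuous_on) (blast intro: has_derivative_continuous)
  fix a v :: "complex ^ 'a"
  show "(\<lambda>t. u (a + t *s v)) holomorphic_on UNIV"
    unfolding holomorphic_on_open[OF open_UNIV]
  proof
    fix s
    obtain L where "Vector_Spaces.linear (*s) (*) L" "(u has_derivative L) (at (a + s *s v))"
      using assms unfolding entire_def by blast
    then show "\<exists>d. ((\<lambda>t. u (a + t *s v)) has_field_derivative d) (at s)"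
      using has_derivative_line by blast
  qed
qed

lemma dir_deriv_DERIV:
  assumes "line_holomorphic f"
  shows "((\<lambda>t. f (a + t *s v)) has_field_derivative dir_deriv v f (a + s *s v)) (at s)"
proof -
  have "(\<lambda>t. f (a + s *s v + t *s v)) = (\<lambda>t. f (a + t *s v)) \<circ> (\<lambda>t. s + t)"
    by (auto simp: o_def vector_sadd_rdistrib add.assoc)
  then have "dir_deriv v f (a + s *s v) = deriv (\<lambda>t. f (a + t *s v)) s"
    by (simp add: dir_deriv_def deriv_shift_0[of _ s])
  then show ?thesis
    using holomorphic_derivI[OF line_holomorphicD(2)[OF assms, of a v UNIV] open_UNIV] by simp
qed

text \<open>Two applications of the maximum principle on the circle of radius \<open>2\<close>: to the difference
  quotient \<open>k\<close> of \<open>g\<close> at the origin, and to the difference quotient of \<open>k\<close>.\<close>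
lemma difference_quotient_error:
  fixes g :: "complex \<Rightarrow> complex"
  assumes g: "g holomorphic_on UNIV" and B: "\<And>t. norm t \<le> 2 \<Longrightarrow> norm (g t) \<le> B"
    and h: "h \<noteq> 0" "norm h \<le> 2"
  shows "norm ((g h - g 0) / h - deriv g 0) \<le> B * norm h"
proof -
  define k where "k = (\<lambda>t. if t = 0 then deriv g 0 else (g t - g 0) / (t - 0))"
  define l where "l = (\<lambda>t. if t = 0 then deriv k 0 else (k t - k 0) / (t - 0))"
  have k: "k holomorphic_on UNIV" unfolding k_def by (rule pole_lemma_open[OF g open_UNIV])
  have l: "l holomorphic_on UNIV" unfolding l_def by (rule pole_lemma_open[OF k open_UNIV])
  have kB: "norm (k t) \<le> B" if "norm t \<le> 2" for t
  proof (rule maximum_modulus_disc[OF k _ that])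
    fix w :: complex assume w: "norm w = 2"
    have "norm (g w - g 0) \<le> 2 * B" using norm_triangle_ineq4[of "g w" "g 0"] B[of w] B[of 0] w by simp
    then show "norm (k w) \<le> B" using w by (auto simp: k_def norm_divide)
  qed simp
  have "norm (l h) \<le> B"
  proof (rule maximum_modulus_disc[OF l _ h(2)])
    fix w :: complex assume w: "norm w = 2"
    have "norm (k w - k 0) \<le> 2 * B" using norm_triangle_ineq4[of "k w" "k 0"] kB[of w] kB[of 0] w by simp
    then show "norm (l w) \<le> B" using w by (auto simp: l_def norm_divide)
  qed simp
  then show ?thesis using h by (simp add: l_def k_def norm_divide divide_le_eq)
qed

definition diff_quot :: "complex ^ 'n \<Rightarrow> (complex ^ 'n \<Rightarrow> complex) \<Rightarrow> nat \<Rightarrow> complex ^ 'n \<Rightarrow> complex" where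
  "diff_quot v f m z = (f (z + inverse (of_nat (Suc m)) *s v) - f z) / inverse (of_nat (Suc m))"

text \<open>This is what carries continuity, holomorphy on lines and differentiation from \<open>f\<close> to its directional
  derivatives: the error of the difference quotients depends only on a bound for \<open>f\<close> on a larger ball.\<close>
lemma uniform_limit_diff_quot:
  fixes f :: "complex ^ 'n \<Rightarrow> complex"
  assumes f: "line_holomorphic f" and A: "bounded A"
  shows "uniform_limit A (diff_quot v f) (dir_deriv v f) sequentially"
proof -
  obtain r where r: "\<And>z. z \<in> A \<Longrightarrow> norm z \<le> r" using A by (auto simp: bounded_iff)
  have "bounded (f ` cball 0 (r + 2 * norm v))"
    by (intro compact_imp_bounded compact_continuous_image line_holomorphicD(1)[OF f] compact_cball)
  then obtain B where B: "\<And>z. norm z \<le> r + 2 * norm v \<Longrightarrow> norm (f z) \<le> B"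
    unfolding bounded_iff by (metis imageI mem_cball_0)
  have err: "norm (diff_quot v f m z - dir_deriv v f z) \<le> B * inverse (of_nat (Suc m))"
    if z: "z \<in> A" for m z
  proof -
    have inv: "norm (inverse (of_nat (Suc m)) :: complex) = inverse (of_nat (Suc m))"
      by (metis norm_inverse norm_of_nat)
    have "norm ((f (z + inverse (of_nat (Suc m)) *s v) - f (z + 0 *s v)) / inverse (of_nat (Suc m))
        - deriv (\<lambda>t. f (z + t *s v)) 0) \<le> B * norm (inverse (of_nat (Suc m)) :: complex)"
    proof (rule difference_quotient_error[OF line_holomorphicD(2)[OF f]])
      fix t :: complex assume t: "norm t \<le> 2"
      have "norm (z + t *s v) \<le> norm z + norm t * norm v"
        using norm_triangle_ineq[of z "t *s v"] by (simp add: norm_scalar_vector_mult)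
      also have "\<dots> \<le> r + 2 * norm v" by (intro add_mono mult_right_mono r z t) simp
      finally show "norm (f (z + t *s v)) \<le> B" by (rule B)
    next
      have "inverse (real (Suc m)) \<le> 1" by (simp add: inverse_le_1_iff)
      then show "norm (inverse (of_nat (Suc m)) :: complex) \<le> 2" using inv by linarith
    qed (simp del: of_nat_Suc)
    then show ?thesis unfolding diff_quot_def dir_deriv_def inv by simp
  qed
  show ?thesis
  proof (rule uniform_limitI)
    fix e :: real assume e: "e > 0"
    have "(\<lambda>m. B * inverse (of_nat (Suc m))) \<longlonglongrightarrow> B * 0"
      by (intro tendsto_mult tendsto_const LIMSEQ_inverse_real_of_nat)
    then have "\<forall>\<^sub>F m in sequentially. B * inverse (of_nat (Suc m)) < e"
      by (rule order_tendstoD) (use e in simp)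
    then show "\<forall>\<^sub>F m in sequentially. \<forall>z\<in>A. dist (diff_quot v f m z) (dir_deriv v f z) < e"
      by eventually_elim (auto simp: dist_norm intro: le_less_trans[OF err])
  qed
qed

lemma diff_quot_line_holomorphic:
  assumes f: "line_holomorphic f"
  shows "continuous_on A (diff_quot v f m)" "(\<lambda>t. diff_quot v f m (a + t *s w)) holomorphic_on B"
proof -
  show "continuous_on A (diff_quot v f m)"
    unfolding diff_quot_def
    by (intro continuous_intros line_holomorphicD(1)[OF f]
          continuous_on_compose2[OF line_holomorphicD(1)[OF f, of UNIV]]) (auto simp del: of_nat_Suc)
  have "(\<lambda>t. f (a + t *s w + c)) = (\<lambda>t. f ((a + c) + t *s w))" for c by (simp add: add_ac)
  then have "(\<lambda>t. f (a + t *s w + c)) holomorphic_on B" for c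
    using line_holomorphicD(2)[OF f, of "a + c" w B] by simp
  then show "(\<lambda>t. diff_quot v f m (a + t *s w)) holomorphic_on B"
    unfolding diff_quot_def
    by (intro holomorphic_intros line_holomorphicD(2)[OF f]) (auto simp del: of_nat_Suc)
qed

lemma uniform_limit_diff_quot_line:
  fixes f :: "complex ^ 'n \<Rightarrow> complex"
  assumes f: "line_holomorphic f" and B: "bounded B"
  shows "uniform_limit B (\<lambda>m t. diff_quot v f m (a + t *s w)) (\<lambda>t. dir_deriv v f (a + t *s w)) sequentially"
proof -
  obtain r where r: "\<And>t. t \<in> B \<Longrightarrow> norm t \<le> r" using B by (auto simp: bounded_iff)
  have "norm (a + t *s w) \<le> norm a + r * norm w" if "t \<in> B" for t
    using norm_triangle_ineq[of a "t *s w"] mult_right_mono[OF r[OF that], of "norm w"]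
    by (simp add: norm_scalar_vector_mult)
  then show ?thesis
    by (intro uniform_limit_compose'[OF uniform_limit_diff_quot[OF f bounded_cball[of 0 "norm a + r * norm w"]]])
       auto
qed

lemma line_holomorphic_dir_deriv:
  assumes f: "line_holomorphic f"
  shows "line_holomorphic (dir_deriv v f)"
  unfolding line_holomorphic_def
proof (intro conjI allI)
  have "continuous_on (ball z 1) (dir_deriv v f)" for z
    by (rule uniform_limit_theorem[OF _ uniform_limit_diff_quot[OF f]])
       (auto simp: diff_quot_line_holomorphic(1)[OF f])
  then show "continuous_on UNIV (dir_deriv v f)"
    by (metis centre_in_ball continuous_at_imp_continuous_on continuous_on_eq_continuous_at open_ball zero_less_one)
  fix a w :: "complex ^ 'a"
  show "(\<lambda>t. dir_deriv v f (a + t *s w)) holomorphic_on UNIV"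
  proof (rule holomorphic_uniform_sequence[OF open_UNIV])
    fix x :: complex
    show "\<exists>d>0. cball x d \<subseteq> UNIV \<and> uniform_limit (cball x d)
        (\<lambda>m t. diff_quot v f m (a + t *s w)) (\<lambda>t. dir_deriv v f (a + t *s w)) sequentially"
      using uniform_limit_diff_quot_line[OF f bounded_cball] by (intro exI[of _ 1]) auto
  qed (rule diff_quot_line_holomorphic(2)[OF f])
qed

text \<open>Differentiation in direction \<open>w\<close> commutes with the difference quotients in direction \<open>v\<close>, and, by
  Weierstrass, with their locally uniform limit.\<close>
lemma dir_deriv_commute:
  assumes f: "line_holomorphic f"
  shows "dir_deriv w (dir_deriv v f) z = dir_deriv v (dir_deriv w f) z"
proof -
  have "(\<lambda>m. deriv (\<lambda>t. diff_quot v f m (z + t *s w)) 0)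
      \<longlonglongrightarrow> deriv (\<lambda>t. dir_deriv v f (z + t *s w)) 0"
    by (rule deriv_complex_uniform_limit[where A = "ball 0 1"])
       (auto simp: diff_quot_line_holomorphic(2)[OF f] intro: uniform_limit_diff_quot_line[OF f])
  moreover have "deriv (\<lambda>t. diff_quot v f m (z + t *s w)) 0 = diff_quot v (dir_deriv w f) m z" for m
  proof -
    have "((\<lambda>t. f (z + t *s w + c)) has_field_derivative dir_deriv w f (z + c)) (at 0)" for c
      using dir_deriv_DERIV[OF f, of "z + c" w 0] by (simp add: add_ac)
    note d = this[of "inverse (of_nat (Suc m)) *s v"] this[of 0, simplified]
    have "((\<lambda>t. diff_quot v f m (z + t *s w)) has_field_derivative diff_quot v (dir_deriv w f) m z) (at 0)"
      unfolding diff_quot_def by (intro DERIV_cdivide DERIV_diff d)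
    then show ?thesis by (rule DERIV_imp_deriv)
  qed
  moreover have "(\<lambda>m. diff_quot v (dir_deriv w f) m z) \<longlonglongrightarrow> dir_deriv v (dir_deriv w f) z"
    by (rule tendsto_uniform_limitI[OF uniform_limit_diff_quot[OF line_holomorphic_dir_deriv[OF f], of "{z}"]]) auto
  ultimately show ?thesis
    unfolding dir_deriv_def[of w "dir_deriv v f"] by (auto intro: LIMSEQ_unique)
qed

lemma partial_deriv_eq_dir_deriv: "partial_deriv j u = dir_deriv (axis j 1) u"
proof
  fix z :: "complex ^ 'a"
  have "(\<chi> i. if i = j then z $ j + t else z $ i) = z + t *s axis j 1" for t
    by (auto simp: vec_eq_iff axis_def)
  then show "partial_deriv j u z = dir_deriv (axis j 1) u z"
    unfolding partial_deriv_def dir_deriv_def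
    by (subst deriv_shift_0) (simp add: o_def)
qed

lemma constant_on_line:
  assumes f: "line_holomorphic f" and "\<And>z. dir_deriv v f z = 0"
  shows "f (a + t *s v) = f a"
proof -
  have "((\<lambda>t. f (a + t *s v)) has_field_derivative 0) (at s within UNIV)" for s
    using dir_deriv_DERIV[OF f, of a v s] assms(2) by simp
  then obtain c where "\<And>t. f (a + t *s v) = c"
    using has_field_derivative_zero_constant[of UNIV "\<lambda>t. f (a + t *s v)"] by auto
  from this[of t] this[of 0] show ?thesis by simp
qed

lemma zero_partial_derivs_imp_constant:
  fixes f :: "complex ^ 'n \<Rightarrow> complex"
  assumes f: "line_holomorphic f" and "\<And>k z. dir_deriv (axis k 1) f z = 0"
  shows "f z = f w"
proof -
  have "\<forall>z w. (\<forall>i. i \<notin> S \<longrightarrow> z $ i = w $ i) \<longrightarrow> f z = f w" if "finite S" for S :: "'n set"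
    using that
  proof (induction S)
    case empty then show ?case by (metis empty_iff vec_eq_iff)
  next
    case (insert k S)
    show ?case
    proof (intro allI impI)
      fix z w :: "complex ^ 'n" assume zw: "\<forall>i. i \<notin> insert k S \<longrightarrow> z $ i = w $ i"
      have "f z = f (z + (w $ k - z $ k) *s axis k 1)"
        using constant_on_line[OF f assms(2)] by metis
      also have "\<dots> = f w"
      proof -
        have "\<forall>i. i \<notin> S \<longrightarrow> (z + (w $ k - z $ k) *s axis k 1) $ i = w $ i"
          using zw by (auto simp: axis_def)
        then show ?thesis using insert.IH by blast
      qed
      finally show "f z = f w" .
    qed
  qed
  from this[of UNIV] show ?thesis by simp
qed

lemma Liouville_line_holomorphic:
  assumes f: "line_holomorphic f" and B: "\<And>z. norm (f z) \<le> B"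
  shows "f z = f w"
proof -
  have "bounded (range (\<lambda>t. f (w + t *s (z - w))))" using B by (auto simp: bounded_iff)
  from Liouville_theorem[OF line_holomorphicD(2)[OF f] this]
  obtain c where "\<And>t. f (w + t *s (z - w)) = c" by (auto simp: constant_on_def)
  from this[of 0] this[of 1] show ?thesis by simp
qed

text \<open>On the line joining a common nonzero point \<open>a\<close> of the functions in \<open>F\<close> to a nonzero point \<open>b\<close> of a
  further function \<open>g\<close>, the identity theorem provides points arbitrarily close to \<open>a\<close> at which \<open>g\<close> does
  not vanish; near \<open>a\<close> the functions in \<open>F\<close> remain nonzero.\<close>
lemma common_nonzero_point:
  assumes "finite F" "\<And>f. f \<in> F \<Longrightarrow> line_holomorphic f" "\<And>f. f \<in> F \<Longrightarrow> \<exists>z. f z \<noteq> 0"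
  shows "\<exists>z. \<forall>f\<in>F. f z \<noteq> 0"
  using assms
proof (induction F)
  case empty then show ?case by simp
next
  case (insert g F)
  then obtain a where a: "\<And>f. f \<in> F \<Longrightarrow> f a \<noteq> 0" by blast
  obtain b where b: "g b \<noteq> 0" using insert.prems(2) by blast
  define l where "l = (\<lambda>t. a + t *s (b - a))"
  have hol: "(\<lambda>t. f (l t)) holomorphic_on UNIV" if "f \<in> insert g F" for f
    unfolding l_def using insert.prems(1)[OF that] by (rule line_holomorphicD)
  have "(\<lambda>t. \<Prod>f\<in>F. f (l t)) holomorphic_on UNIV"
    using hol by (intro holomorphic_on_prod) auto
  then have cont: "isCont (\<lambda>t. \<Prod>f\<in>F. f (l t)) 0"
    using holomorphic_on_imp_continuous_on continuous_on_eq_continuous_at by blast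
  have nz: "(\<Prod>f\<in>F. f (l 0)) \<noteq> 0" using a insert.hyps by (simp add: l_def)
  obtain e where e: "e > 0" "\<And>t. dist 0 t < e \<Longrightarrow> (\<Prod>f\<in>F. f (l t)) \<noteq> 0"
    using continuous_at_avoid[where f = "\<lambda>t. \<Prod>f\<in>F. f (l t)", OF cont nz] by blast
  have "\<exists>t\<in>ball 0 e. g (l t) \<noteq> 0"
  proof (rule ccontr)
    assume "\<not> ?thesis"
    then have *: "g (l t) = 0" if "t \<in> ball 0 e" for t using that by blast
    have "g (l 1) = 0"
      by (rule analytic_continuation_open[where s = "ball 0 e" and s' = UNIV and f = "\<lambda>t. g (l t)"
            and g = "\<lambda>_. 0" and z = 1]) (use e(1) in \<open>simp_all add: hol * connected_UNIV\<close>)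
    with b show False by (simp add: l_def)
  qed
  then obtain t where "dist 0 t < e" "g (l t) \<noteq> 0" by auto
  then show ?case using e(2)[of t] insert.hyps by (intro exI[of _ "l t"]) auto
qed

section \<open>A growth lemma\<close>

text \<open>Apply the hypothesis with \<open>x = L(r)\<close>, where \<open>L = ln \<circ> M\<close>. As \<open>e\<^sup>L\<close> exceeds every expression of
  order \<open>L\<^sup>2\<close> for large \<open>L\<close>, the value \<open>M (r (1 + 1 / L(r)))\<close> must be at least \<open>M(r)\<^sup>2\<close>: the step
  \<open>r \<mapsto> r (1 + 1 / L(r))\<close> doubles \<open>L\<close>. Iterating it, the relative step lengths decrease geometrically,
  so all iterates stay below a fixed radius although \<open>M\<close> is unbounded along them.\<close>
lemma bounded_if_self_improving:
  fixes M :: "real \<Rightarrow> real"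
  assumes mono: "\<And>r s. 1 \<le> r \<Longrightarrow> r \<le> s \<Longrightarrow> M r \<le> M s" and c: "b > 0" "c > 0"
    and ineq: "\<And>r x. 1 \<le> r \<Longrightarrow> 1 \<le> x \<Longrightarrow> M r \<le> a + b * x * ln (c * x * (1 + M (r * (1 + 1 / x))))"
  shows "\<exists>B. \<forall>r\<ge>1. M r \<le> B"
proof (rule ccontr)
  assume unbdd: "\<not> ?thesis"
  have "\<forall>\<^sub>F L in at_top. a + b * L * ln (c * L * (1 + exp (2 * L))) < exp L"
    using c by real_asymp
  then obtain L0' where L0': "\<And>L. L \<ge> L0' \<Longrightarrow> a + b * L * ln (c * L * (1 + exp (2 * L))) < exp L"
    by (auto simp: eventually_at_top_linorder)
  define L0 where "L0 = max 1 L0'"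
  have L0: "L0 \<ge> 1" "\<And>L. L \<ge> L0 \<Longrightarrow> a + b * L * ln (c * L * (1 + exp (2 * L))) < exp L"
    using L0' by (auto simp: L0_def)
  obtain r0 where r0: "r0 \<ge> 1" "M r0 > exp L0" using unbdd by (meson not_le)
  define L where "L = (\<lambda>r. ln (M r))"
  have pos: "M r > 0" if "r \<ge> r0" for r
    using mono[OF r0(1) that] r0(2) exp_gt_zero[of L0] by linarith
  have Lge: "L r \<ge> L0" if "r \<ge> r0" for r
    using mono[OF r0(1) that] r0(2) pos[OF that] by (simp add: L_def ln_ge_iff)
  have step: "2 * L r \<le> L (r * (1 + 1 / L r))" if r: "r \<ge> r0" for r
  proof (rule ccontr)
    assume less: "\<not> ?thesis"
    define s where "s = r * (1 + 1 / L r)"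
    have L1: "L r \<ge> 1" using Lge[OF r] L0(1) by simp
    have rs: "s \<ge> r" using r r0(1) L1 by (simp add: s_def field_simps)
    have s: "s \<ge> r0" using rs r by simp
    have "exp (L s) \<le> exp (2 * L r)" using less by (simp add: s_def)
    then have "M s \<le> exp (2 * L r)" using pos[OF s] by (simp add: L_def)
    then have "c * L r * (1 + M s) \<le> c * L r * (1 + exp (2 * L r))"
      using c L1 by (intro mult_left_mono) auto
    moreover have "0 < c * L r * (1 + M s)" using c L1 pos[OF s] by (intro mult_pos_pos) auto
    ultimately have "ln (c * L r * (1 + M s)) \<le> ln (c * L r * (1 + exp (2 * L r)))"
      by (rule ln_mono)
    then have "b * L r * ln (c * L r * (1 + M s)) \<le> b * L r * ln (c * L r * (1 + exp (2 * L r)))"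
      using c L1 by (intro mult_left_mono) auto
    moreover have "M r \<le> a + b * L r * ln (c * L r * (1 + M s))"
      using ineq[of r "L r"] r r0(1) L1 by (simp add: s_def)
    moreover have "exp (L r) = M r" using pos[OF r] by (simp add: L_def)
    ultimately show False using L0(2)[OF Lge[OF r]] by linarith
  qed
  \<comment> \<open>\<open>L (R k) \<ge> 2\<^sup>k\<close> bounds the \<open>k\<close>-th factor by \<open>exp (1 / 2\<^sup>k)\<close>; the exponents sum to \<open>2 - 2 / 2\<^sup>k\<close>.\<close>
  define R where "R = (\<lambda>k. ((\<lambda>r. r * (1 + 1 / L r)) ^^ k) r0)"
  have R: "r0 \<le> R k \<and> R k \<le> r0 * exp (2 - 2 / 2 ^ k) \<and> 2 ^ k \<le> L (R k)" for k
  proof (induction k)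
    case 0
    then show ?case using Lge[of r0] L0(1) by (simp add: R_def)
  next
    case (Suc k)
    have RS: "R (Suc k) = R k * (1 + 1 / L (R k))" by (simp add: R_def)
    have Lpos: "L (R k) > 0" using Suc zero_less_power[of "2::real" k] by linarith
    have "1 + 1 / L (R k) \<le> exp (1 / L (R k))" by (rule exp_ge_add_one_self)
    also have "\<dots> \<le> exp (1 / 2 ^ k)" using Suc Lpos by (simp add: frac_le)
    finally have "R (Suc k) \<le> (r0 * exp (2 - 2 / 2 ^ k)) * exp (1 / 2 ^ k)"
      unfolding RS using Suc r0(1) Lpos by (intro mult_mono) auto
    also have "\<dots> = r0 * exp (2 - 2 / 2 ^ Suc k)"
      by (simp add: mult.assoc flip: exp_add)
    finally have "R (Suc k) \<le> r0 * exp (2 - 2 / 2 ^ Suc k)" .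
    moreover have "R k \<le> R (Suc k)" unfolding RS using Suc r0(1) Lpos by (simp add: algebra_simps)
    moreover have "2 ^ Suc k \<le> L (R (Suc k))" using step[of "R k"] Suc unfolding RS by simp
    ultimately show ?case using Suc by simp
  qed
  have "2 ^ k \<le> M (r0 * exp 2)" for k :: nat
  proof -
    have "2 ^ k \<le> exp (L (R k))"
      using R[of k] exp_ge_add_one_self[of "L (R k)"] by linarith
    also have "\<dots> = M (R k)" using R[of k] pos by (simp add: L_def)
    also have "\<dots> \<le> M (r0 * exp 2)"
    proof (rule mono)
      have "r0 * exp (2 - 2 / 2 ^ k) \<le> r0 * exp 2" using r0(1) by (intro mult_left_mono) auto
      then show "R k \<le> r0 * exp 2" using R[of k] by linarith
    qed (use R[of k] r0(1) in linarith)
    finally show ?thesis .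
  qed
  then show False using real_arch_pow[of 2 "M (r0 * exp 2)"] by (auto simp: not_le[symmetric])
qed

section \<open>Oscillation along the paths of a finite graph\<close>

lemma oscillation_along_path:
  assumes "(j, k) \<in> E\<^sup>*"
  shows "\<exists>n::nat. \<forall>(\<phi> :: 'a \<Rightarrow> real) (D :: real). (\<forall>(a, b)\<in>E. \<bar>\<phi> a - \<phi> b\<bar> \<le> D) \<longrightarrow> \<bar>\<phi> j - \<phi> k\<bar> \<le> n * D"
  using assms
proof (induction rule: rtrancl_induct)
  case base
  then show ?case by (intro exI[of _ 0]) simp
next
  case (step k l)
  then obtain n :: nat where n: "\<And>(\<phi> :: 'a \<Rightarrow> real) (D :: real). (\<forall>(a, b)\<in>E. \<bar>\<phi> a - \<phi> b\<bar> \<le> D) \<Longrightarrow> \<bar>\<phi> j - \<phi> k\<bar> \<le> n * D"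
    by blast
  show ?case
  proof (intro exI[of _ "Suc n"] allI impI)
    fix \<phi> :: "'a \<Rightarrow> real" and D :: real assume *: "\<forall>(a, b)\<in>E. \<bar>\<phi> a - \<phi> b\<bar> \<le> D"
    have "\<bar>\<phi> k - \<phi> l\<bar> \<le> D" using * step.hyps by blast
    then show "\<bar>\<phi> j - \<phi> l\<bar> \<le> Suc n * D" using n[OF *] by (simp add: algebra_simps)
  qed
qed

text \<open>If \<open>\<phi>\<close> varies by at most \<open>D\<close> along every edge, then its value at \<open>j\<close> differs from its mean over the
  set reachable from \<open>j\<close> by a multiple of \<open>D\<close>. The factor \<open>m\<close> depends on the graph only; summing
  over all pairs of vertices is crude, but makes it independent of \<open>j\<close>.\<close>
lemma bound_by_component_sum:
  fixes E :: "('a::finite \<times> 'a) set"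
  obtains m :: nat where
    "\<And>(\<phi> :: 'a \<Rightarrow> real) (D :: real) j. (\<And>a b. (a, b) \<in> E \<Longrightarrow> \<bar>\<phi> a - \<phi> b\<bar> \<le> D) \<Longrightarrow> D \<ge> 0 \<Longrightarrow>
       \<bar>\<phi> j\<bar> \<le> \<bar>\<Sum>k\<in>E\<^sup>* `` {j}. \<phi> k\<bar> + m * D"
proof -
  have "\<forall>e\<in>E\<^sup>*. \<exists>n::nat. \<forall>(\<phi> :: 'a \<Rightarrow> real) (D :: real).
      (\<forall>(a, b)\<in>E. \<bar>\<phi> a - \<phi> b\<bar> \<le> D) \<longrightarrow> \<bar>\<phi> (fst e) - \<phi> (snd e)\<bar> \<le> n * D"
    using oscillation_along_path by (metis prod.collapse)
  then obtain n :: "'a \<times> 'a \<Rightarrow> nat" where n: "\<And>j k (\<phi> :: 'a \<Rightarrow> real) (D :: real). (j, k) \<in> E\<^sup>* \<Longrightarrow>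
      (\<forall>(a, b)\<in>E. \<bar>\<phi> a - \<phi> b\<bar> \<le> D) \<Longrightarrow> \<bar>\<phi> j - \<phi> k\<bar> \<le> n (j, k) * D"
    unfolding bchoice_iff by (metis fst_conv snd_conv)
  show thesis
  proof (rule that[of "\<Sum>e\<in>UNIV. n e"])
    fix \<phi> :: "'a \<Rightarrow> real" and D :: real and j
    assume *: "\<And>a b. (a, b) \<in> E \<Longrightarrow> \<bar>\<phi> a - \<phi> b\<bar> \<le> D" and D: "D \<ge> 0"
    define C where "C = E\<^sup>* `` {j}"
    have "card C > 0" unfolding C_def by (auto simp: card_gt_0_iff)
    then have "\<bar>\<phi> j\<bar> \<le> real (card C) * \<bar>\<phi> j\<bar>" by (simp add: mult_le_cancel_right1)
    also have "\<dots> = \<bar>(\<Sum>k\<in>C. \<phi> k) + (\<Sum>k\<in>C. \<phi> j - \<phi> k)\<bar>"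
      by (simp add: sum_subtractf abs_mult)
    also have "\<dots> \<le> \<bar>\<Sum>k\<in>C. \<phi> k\<bar> + (\<Sum>k\<in>C. \<bar>\<phi> j - \<phi> k\<bar>)"
      by (intro order_trans[OF abs_triangle_ineq] add_left_mono sum_abs)
    also have "(\<Sum>k\<in>C. \<bar>\<phi> j - \<phi> k\<bar>) \<le> (\<Sum>k\<in>C. n (j, k) * D)"
    proof (rule sum_mono)
      have "\<forall>(a, b)\<in>E. \<bar>\<phi> a - \<phi> b\<bar> \<le> D" using * by auto
      then show "\<bar>\<phi> j - \<phi> k\<bar> \<le> n (j, k) * D" if "k \<in> C" for k
        using n[of j k \<phi> D] that by (simp add: C_def)
    qed
    also have "\<dots> = (\<Sum>e\<in>Pair j ` C. n e) * D"
      by (simp add: sum.reindex inj_on_def sum_distrib_right)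
    also have "\<dots> \<le> (\<Sum>e\<in>UNIV. n e) * D"
      by (intro mult_right_mono D of_nat_mono sum_mono2) auto
    finally show "\<bar>\<phi> j\<bar> \<le> \<bar>\<Sum>k\<in>E\<^sup>* `` {j}. \<phi> k\<bar> + real (\<Sum>e\<in>UNIV. n e) * D"
      by (simp add: C_def)
  qed
qed

section \<open>Partial derivatives whose product is constant\<close>

lemma logarithmic_dir_deriv_bound:
  fixes f :: "complex ^ 'n \<Rightarrow> complex"
  assumes f: "line_holomorphic f" and nz: "\<And>z. f z \<noteq> 0" and s: "s > 0" and v: "norm v \<le> 1"
    and N: "\<And>z. dist c z \<le> s \<Longrightarrow> \<bar>ln (norm (f z))\<bar> \<le> N"
  shows "norm (dir_deriv v f c / f c) \<le> 8 * N / s"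
proof -
  have "norm (deriv (\<lambda>t. f (c + t *s v)) 0 / f (c + 0 *s v)) \<le> 8 * N / s"
  proof (rule logarithmic_derivative_bound[OF line_holomorphicD(2)[OF f] nz s N])
    fix t :: complex assume "norm t < s"
    then show "dist c (c + t *s v) \<le> s"
      using mult_mono[of "norm t" s "norm v" 1] v s by (simp add: dist_norm norm_scalar_vector_mult)
  qed
  then show ?thesis by (simp add: dir_deriv_def)
qed

lemma unit_direction:
  fixes z0 z :: "complex ^ 'n"
  obtains v t where "norm v \<le> 1" "z = z0 + t *s v" "norm t = dist z0 z"
proof (cases "z = z0")
  case True
  then show thesis using that[of 0 0] by simp
next
  case False
  let ?d = "complex_of_real (dist z0 z)"
  have d: "?d \<noteq> 0" using False by simp
  show thesis
  proof (rule that[of "inverse ?d *s (z - z0)" ?d])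
    show "norm (inverse ?d *s (z - z0)) \<le> 1"
      unfolding norm_scalar_vector_mult using d
      by (simp add: norm_inverse dist_norm norm_minus_commute)
    show "z = z0 + ?d *s (inverse ?d *s (z - z0))"
      using d by (simp add: vector_smult_assoc)
  qed simp
qed

text \<open>On the complex line through \<open>z0\<close> and \<open>z\<close> put \<open>b = \<partial>\<^sub>k p\<^sub>j / p\<^sub>j\<close> and \<open>q = p\<^sub>j / p\<^sub>k\<close>. Then
  \<open>b q = \<partial>\<^sub>k p\<^sub>j / p\<^sub>k = \<partial>\<^sub>j p\<^sub>k / p\<^sub>k\<close>, so that both \<open>b\<close> and \<open>b q\<close> are logarithmic derivatives and therefore
  not much larger than \<open>N\<close>. The gap between the radii \<open>r\<close> and \<open>r (1 + 1 / x)\<close> is cut into three equal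
  parts: one each for the logarithmic derivatives, for the division by zeros, and for the
  Borel-Caratheodory inequality.\<close>
lemma ratio_of_partials_bound:
  fixes u :: "complex ^ 'n \<Rightarrow> complex"
  defines "p \<equiv> \<lambda>j. dir_deriv (axis j 1) u"
  assumes u: "line_holomorphic u" and nz: "\<And>i z. p i z \<noteq> 0"
    and H: "dir_deriv (axis k 1) (p j) z0 \<noteq> 0"
    and r: "r \<ge> 1" and x: "x \<ge> 1"
    and N: "\<And>i z. dist z0 z \<le> r * (1 + 1 / x) \<Longrightarrow> \<bar>ln (norm (p i z))\<bar> \<le> N"
    and z: "dist z0 z \<le> r"
  shows "ln (norm (p j z / p k z)) \<le>
    7 * x * ln (24 * x * (1 + N) / norm (dir_deriv (axis k 1) (p j) z0 / p j z0))"
proof -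
  \<comment> \<open>The radii used are \<open>r < r + \<eta> < r + 2 \<eta> < r + 3 \<eta> = r (1 + 1 / x)\<close>.\<close>
  define \<eta> where "\<eta> = r / (3 * x)"
  define K where "K = 24 * x * (1 + N)"
  have p: "line_holomorphic (p i)" for i
    unfolding p_def by (rule line_holomorphic_dir_deriv[OF u])
  have \<eta>: "\<eta> > 0" using r x by (simp add: \<eta>_def)
  have outer: "r + 3 * \<eta> = r * (1 + 1 / x)" using x by (simp add: \<eta>_def field_simps)
  have N0: "N \<ge> 0" using N[of z0 j] r x by (simp add: order_trans[OF abs_ge_zero])
  have bound: "norm (dir_deriv (axis l 1) (p i) c / p i c) \<le> K" if c: "dist z0 c \<le> r + 2 * \<eta>" for i l c
  proof -
    have "norm (dir_deriv (axis l 1) (p i) c / p i c) \<le> 8 * N / \<eta>"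
    proof (rule logarithmic_dir_deriv_bound[OF p nz \<eta>])
      fix y assume y: "dist c y \<le> \<eta>"
      show "\<bar>ln (norm (p i y))\<bar> \<le> N"
        by (rule N) (use dist_triangle[of z0 y c] y c outer in linarith)
    qed (simp add: norm_axis_1)
    also have "\<dots> = 24 * x * N / r" using r x by (simp add: \<eta>_def)
    also have "\<dots> \<le> 24 * x * N / 1" by (rule divide_left_mono) (use r x N0 in auto)
    also have "\<dots> \<le> K" using x by (simp add: K_def algebra_simps)
    finally show ?thesis .
  qed
  obtain v t where v: "norm v \<le> 1" "z = z0 + t *s v" "norm t = dist z0 z"
    by (rule unit_direction)
  define b where "b = (\<lambda>t. dir_deriv (axis k 1) (p j) (z0 + t *s v) / p j (z0 + t *s v))"
  define q where "q = (\<lambda>t. p j (z0 + t *s v) / p k (z0 + t *s v))"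
  have on_line: "dist z0 (z0 + s *s v) \<le> r + 2 * \<eta>" if "norm s = r + 2 * \<eta>" for s
    using mult_left_le[OF v(1) norm_ge_zero[of s]] that by (simp add: dist_norm norm_scalar_vector_mult)
  have "ln (norm (q t)) \<le> (1 + 2 * r / ((r + \<eta>) - r)) * ln (K / norm (b 0))"
  proof (rule nonvanishing_quotient_bound[where b = b and q = q and K = K and R = "r + 2 * \<eta>"])
    show "b holomorphic_on UNIV" "q holomorphic_on UNIV"
      unfolding b_def q_def
      by (intro holomorphic_intros line_holomorphicD(2)[OF p] nz
            line_holomorphicD(2)[OF line_holomorphic_dir_deriv[OF p]])+
    show "q s \<noteq> 0" for s by (simp add: q_def nz)
    show "b 0 \<noteq> 0" using H nz by (simp add: b_def)
    fix s :: complex assume s: "norm s = r + 2 * \<eta>"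
    show "norm (b s) \<le> K" unfolding b_def by (rule bound[OF on_line[OF s]])
    have "b s * q s = dir_deriv (axis k 1) (p j) (z0 + s *s v) / p k (z0 + s *s v)"
      by (simp add: b_def q_def nz)
    also have "dir_deriv (axis k 1) (p j) (z0 + s *s v) = dir_deriv (axis j 1) (p k) (z0 + s *s v)"
      unfolding p_def by (rule dir_deriv_commute[OF u])
    finally have "b s * q s = dir_deriv (axis j 1) (p k) (z0 + s *s v) / p k (z0 + s *s v)" .
    then show "norm (b s * q s) \<le> K" using bound[OF on_line[OF s], of j k] by simp
  qed (use v z \<eta> in auto)
  also have "1 + 2 * r / ((r + \<eta>) - r) = 1 + 6 * x" using r x by (simp add: \<eta>_def)
  also have "(1 + 6 * x) * ln (K / norm (b 0)) \<le> 7 * x * ln (K / norm (b 0))"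
  proof (rule mult_right_mono)
    have "norm (b 0) \<le> K" using bound[of z0 k j] r \<eta> by (simp add: b_def)
    moreover have "norm (b 0) > 0" using H nz by (simp add: b_def)
    ultimately show "0 \<le> ln (K / norm (b 0))" by (simp add: le_divide_eq)
  qed (use x in simp)
  finally show ?thesis using v(2) by (simp add: q_def b_def K_def)
qed

lemma line_holomorphic_prod:
  assumes "\<And>k. k \<in> C \<Longrightarrow> line_holomorphic (p k)"
  shows "line_holomorphic (\<lambda>z. \<Prod>k\<in>C. p k z)"
  using assms unfolding line_holomorphic_def
  by (auto intro!: continuous_on_prod holomorphic_on_prod)

lemma dir_deriv_prod:
  assumes p: "\<And>k. k \<in> C \<Longrightarrow> line_holomorphic (p k)" and nz: "\<And>k z. k \<in> C \<Longrightarrow> p k z \<noteq> 0"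
  shows "dir_deriv v (\<lambda>z. \<Prod>k\<in>C. p k z) z = (\<Prod>k\<in>C. p k z) * (\<Sum>k\<in>C. dir_deriv v (p k) z / p k z)"
proof -
  have "((\<lambda>t. \<Prod>k\<in>C. p k (z + t *s v)) has_field_derivative
      (\<Prod>k\<in>C. p k (z + 0 *s v)) * (\<Sum>k\<in>C. dir_deriv v (p k) (z + 0 *s v) / p k (z + 0 *s v))) (at 0)"
    by (rule has_field_derivative_prod') (use nz dir_deriv_DERIV[OF p] in blast)+
  then show ?thesis unfolding dir_deriv_def by (simp add: DERIV_imp_deriv)
qed

text \<open>If \<open>k\<close> lies in a component \<open>C\<close> and \<open>l\<close> does not, then \<open>\<partial>\<^sub>l p\<^sub>k = 0\<close>. So the product over \<open>C\<close> does not
  depend on the variables outside \<open>C\<close>. Nor does it depend on those inside: for \<open>l \<in> C\<close> the factors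
  outside \<open>C\<close> contribute nothing to the logarithmic derivative of the full product in direction \<open>l\<close>,
  and that one vanishes because the full product is constant.\<close>
lemma component_product_constant:
  fixes u :: "complex ^ 'n \<Rightarrow> complex"
  defines "p \<equiv> \<lambda>j. dir_deriv (axis j 1) u"
  defines "E \<equiv> {(j, k). \<exists>z. dir_deriv (axis k 1) (p j) z \<noteq> 0}"
  assumes u: "line_holomorphic u" and c: "\<And>z. (\<Prod>j\<in>UNIV. p j z) = c" "c \<noteq> 0"
  shows "(\<Prod>k\<in>E\<^sup>* `` {j}. p k z) = (\<Prod>k\<in>E\<^sup>* `` {j}. p k w)"
proof -
  define C where "C = E\<^sup>* `` {j}"
  have p: "line_holomorphic (p i)" for i
    unfolding p_def by (rule line_holomorphic_dir_deriv[OF u])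
  have nz: "p i z \<noteq> 0" for i z using c by (metis UNIV_I finite_class.finite_UNIV prod_zero)
  have sym: "dir_deriv (axis l 1) (p k) z = dir_deriv (axis k 1) (p l) z" for k l z
    unfolding p_def by (rule dir_deriv_commute[OF u])
  have separate: "dir_deriv (axis l 1) (p k) z = 0" if "k \<in> C" "l \<notin> C" for k l z
    using that by (auto simp: C_def E_def intro: rtrancl_into_rtrancl)
  have "dir_deriv (axis l 1) (\<lambda>z. \<Prod>k\<in>C. p k z) z = 0" for l z
  proof -
    have "(\<Sum>k\<in>C. dir_deriv (axis l 1) (p k) z / p k z) = 0"
    proof (cases "l \<in> C")
      case True
      have "(\<Sum>k\<in>C. dir_deriv (axis l 1) (p k) z / p k z) =
          (\<Sum>k\<in>UNIV. dir_deriv (axis l 1) (p k) z / p k z)"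
        by (rule sum.mono_neutral_left) (auto simp: sym[of l] separate[OF True])
      also have "c * \<dots> = dir_deriv (axis l 1) (\<lambda>z. \<Prod>k\<in>UNIV. p k z) z"
        using dir_deriv_prod[of UNIV p "axis l 1" z] p nz c(1) by simp
      also have "\<dots> = 0" by (simp add: c(1) dir_deriv_def)
      finally show ?thesis using c(2) by simp
    qed (simp add: separate)
    then show ?thesis using dir_deriv_prod[of C p "axis l 1" z] p nz by simp
  qed
  then show ?thesis
    using zero_partial_derivs_imp_constant[OF line_holomorphic_prod[of C p]] p
    unfolding C_def by blast
qed

text \<open>Here the estimates are assembled. \<open>M r\<close> is the maximum over the ball of radius \<open>r\<close> of the sum of all
  \<open>\<bar>ln \<bar>p\<^sub>j\<bar>\<bar>\<close>. The centre \<open>z0\<close> is chosen so that none of the second derivatives that are not identically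
  zero vanishes there; this gives one constant \<open>\<beta>\<close> for all edges and all radii.\<close>
lemma partials_constant:
  fixes u :: "complex ^ 'n \<Rightarrow> complex"
  defines "p \<equiv> \<lambda>j. dir_deriv (axis j 1) u"
  assumes u: "line_holomorphic u" and c: "\<And>z. (\<Prod>j\<in>UNIV. p j z) = c" "c \<noteq> 0"
  shows "p j z = p j w"
proof -
  have p: "line_holomorphic (p i)" for i
    unfolding p_def by (rule line_holomorphic_dir_deriv[OF u])
  have nz: "p i z \<noteq> 0" for i z using c by (metis UNIV_I finite_class.finite_UNIV prod_zero)
  define H where "H = (\<lambda>(j, k). dir_deriv (axis k 1) (p j))"
  define E where "E = {e. \<exists>z. H e z \<noteq> 0}"
  have E_eq: "E = {(j, k). \<exists>z. dir_deriv (axis k 1) (p j) z \<noteq> 0}" by (auto simp: E_def H_def)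
  have sym: "(k, j) \<in> E" if "(j, k) \<in> E" for j k
    using that dir_deriv_commute[OF u] unfolding E_eq p_def by simp
  define \<phi> where "\<phi> = (\<lambda>z j. ln (norm (p j z)))"
  have "\<exists>z. \<forall>f\<in>H ` E. f z \<noteq> 0"
    by (rule common_nonzero_point) (auto simp: H_def E_def intro!: line_holomorphic_dir_deriv p)
  then obtain z0 where z0: "\<And>e. e \<in> E \<Longrightarrow> H e z0 \<noteq> 0" by auto
  \<comment> \<open>The element \<open>1\<close> covers a graph without edges and makes the bound \<open>D\<close> below nonnegative.\<close>
  define \<beta> where "\<beta> = Min (insert 1 ((\<lambda>(j, k). norm (H (j, k) z0 / p j z0)) ` E))"
  have \<beta>: "0 < \<beta>" "\<beta> \<le> 1" "\<And>j k. (j, k) \<in> E \<Longrightarrow> \<beta> \<le> norm (H (j, k) z0 / p j z0)"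
    using z0 nz by (auto simp: \<beta>_def split: prod.splits intro!: Min_le)
  define \<Lambda> where "\<Lambda> = (\<lambda>z. \<Sum>j\<in>UNIV. \<bar>\<phi> z j\<bar>)"
  define M where "M = (\<lambda>r. SUP z\<in>cball z0 r. \<Lambda> z)"
  have cont: "continuous_on A \<Lambda>" for A
    unfolding \<Lambda>_def \<phi>_def by (intro continuous_intros line_holomorphicD(1)[OF p]) (simp add: nz)
  have bdd: "bdd_above (\<Lambda> ` cball z0 r)" for r
    by (intro bounded_imp_bdd_above compact_imp_bounded compact_continuous_image cont compact_cball)
  have le_M: "\<Lambda> z \<le> M r" if "dist z0 z \<le> r" for z r
    unfolding M_def by (rule cSUP_upper[OF _ bdd]) (use that in simp)
  have \<phi>_le: "\<bar>\<phi> z i\<bar> \<le> \<Lambda> z" for z i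
    unfolding \<Lambda>_def by (rule member_le_sum) auto
  have \<Lambda>0: "\<Lambda> z \<ge> 0" for z by (simp add: \<Lambda>_def sum_nonneg)
  obtain m :: nat where m: "\<And>(\<phi> :: 'n \<Rightarrow> real) (D :: real) j. (\<And>a b. (a, b) \<in> E \<Longrightarrow> \<bar>\<phi> a - \<phi> b\<bar> \<le> D) \<Longrightarrow> D \<ge> 0 \<Longrightarrow>
       \<bar>\<phi> j\<bar> \<le> \<bar>\<Sum>k\<in>E\<^sup>* `` {j}. \<phi> k\<bar> + m * D"
    using bound_by_component_sum[of E] by metis
  define a where "a = (\<Sum>j\<in>UNIV. \<bar>\<Sum>k\<in>E\<^sup>* `` {j}. \<phi> z0 k\<bar>)"
  \<comment> \<open>The summand \<open>1\<close> keeps \<open>b\<close> positive when \<open>m = 0\<close>.\<close>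
  define b where "b = 7 * (real (CARD('n)) * real m + 1)"
  have component_sum: "(\<Sum>k\<in>E\<^sup>* `` {j}. \<phi> z k) = (\<Sum>k\<in>E\<^sup>* `` {j}. \<phi> z0 k)" for z j
  proof -
    have "(\<Sum>k\<in>E\<^sup>* `` {j}. \<phi> z k) = ln (norm (\<Prod>k\<in>E\<^sup>* `` {j}. p k z))" for z
      by (simp add: \<phi>_def nz ln_prod flip: prod_norm)
    moreover have "(\<Prod>k\<in>E\<^sup>* `` {j}. p k z) = (\<Prod>k\<in>E\<^sup>* `` {j}. p k z0)"
      unfolding E_eq p_def by (rule component_product_constant[OF u c[unfolded p_def]])
    ultimately show ?thesis by (simp only:)
  qed
  have ineq: "M r \<le> a + b * x * ln (24 / \<beta> * x * (1 + M (r * (1 + 1 / x))))" if r: "1 \<le> r" and x: "1 \<le> x" for r x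
  proof -
    define N where "N = M (r * (1 + 1 / x))"
    have N0: "N \<ge> 0" unfolding N_def using le_M[of z0 "r * (1 + 1 / x)"] \<Lambda>0[of z0] r x by simp
    define D where "D = 7 * x * ln (24 / \<beta> * x * (1 + N))"
    have "1 * 1 * 1 \<le> 24 / \<beta> * x * (1 + N)"
      using \<beta> x N0 by (intro mult_mono) (auto simp: le_divide_eq)
    then have D0: "D \<ge> 0" using x by (simp add: D_def)
    have one_sided: "\<phi> z j - \<phi> z k \<le> D" if jk: "(j, k) \<in> E" and z: "dist z0 z \<le> r" for j k z
    proof -
      let ?h = "norm (dir_deriv (axis k 1) (p j) z0 / p j z0)"
      have h: "dir_deriv (axis k 1) (p j) z0 \<noteq> 0" "\<beta> \<le> ?h"
        using z0[OF jk] \<beta>(3)[OF jk] by (simp_all add: H_def)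
      have "\<phi> z j - \<phi> z k = ln (norm (p j z / p k z))"
        by (simp add: \<phi>_def norm_divide ln_div nz)
      also have "\<dots> \<le> 7 * x * ln (24 * x * (1 + N) / ?h)"
        unfolding p_def
      proof (rule ratio_of_partials_bound[OF u _ _ r x _ z])
        fix i y assume "dist z0 y \<le> r * (1 + 1 / x)"
        from order_trans[OF \<phi>_le le_M[OF this]]
        show "\<bar>ln (norm (dir_deriv (axis i 1) u y))\<bar> \<le> N" by (simp add: \<phi>_def N_def p_def)
      qed (use nz h in \<open>simp_all add: p_def\<close>)
      also have "\<dots> \<le> D"
        unfolding D_def
      proof (intro mult_left_mono ln_mono)
        have "24 * x * (1 + N) / ?h \<le> 24 * x * (1 + N) / \<beta>"
          using h \<beta>(1) x N0 by (intro divide_left_mono) (auto simp: nz)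
        then show "24 * x * (1 + N) / ?h \<le> 24 / \<beta> * x * (1 + N)" by simp
        show "24 * x * (1 + N) / ?h > 0" using h(1) x N0 by (intro divide_pos_pos mult_pos_pos) (auto simp: nz)
      qed (use x in auto)
      finally show ?thesis .
    qed
    have "\<Lambda> z \<le> a + b * x * ln (24 / \<beta> * x * (1 + N))" if z: "z \<in> cball z0 r" for z
    proof -
      have edge: "\<bar>\<phi> z j - \<phi> z k\<bar> \<le> D" if "(j, k) \<in> E" for j k
        using one_sided[OF that, of z] one_sided[OF sym[OF that], of z] z by (auto simp: abs_le_iff)
      have "\<Lambda> z \<le> (\<Sum>j\<in>UNIV. \<bar>\<Sum>k\<in>E\<^sup>* `` {j}. \<phi> z k\<bar> + m * D)"
        unfolding \<Lambda>_def by (intro sum_mono m[where \<phi> = "\<phi> z", OF edge D0])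
      also have "\<dots> = a + real (CARD('n)) * m * D"
        by (simp add: component_sum[of z] sum.distrib a_def)
      also have "\<dots> \<le> a + (real (CARD('n)) * m + 1) * D"
        using D0 by (simp add: algebra_simps)
      also have "\<dots> = a + b * x * ln (24 / \<beta> * x * (1 + N))"
        by (simp add: b_def D_def)
      finally show ?thesis .
    qed
    then have "(SUP z\<in>cball z0 r. \<Lambda> z) \<le> a + b * x * ln (24 / \<beta> * x * (1 + N))"
      by (intro cSUP_least) (use r in auto)
    then show ?thesis unfolding N_def M_def .
  qed
  have "\<exists>B. \<forall>r\<ge>1. M r \<le> B"
  proof (rule bounded_if_self_improving[OF _ _ _ ineq])
    show "M r \<le> M s" if "1 \<le> r" "r \<le> s" for r s
      unfolding M_def
    proof (rule cSUP_subset_mono[where f = \<Lambda> and g = \<Lambda>, OF _ bdd])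
      show "cball z0 r \<subseteq> cball z0 s" using that by (simp add: subset_cball)
    qed (use that in auto)
    show "0 < b" by (simp add: b_def add_nonneg_pos)
    show "0 < 24 / \<beta>" using \<beta> by simp
  qed
  then obtain B where B: "\<And>r. r \<ge> 1 \<Longrightarrow> M r \<le> B" by blast
  have "norm (p j z) \<le> exp B" for z
  proof -
    have "\<phi> z j \<le> B"
      using \<phi>_le[of z j] le_M[of z "max 1 (dist z0 z)"] B[of "max 1 (dist z0 z)"] by simp
    then have "exp (\<phi> z j) \<le> exp B" by (simp only: exp_le_cancel_iff)
    moreover have "exp (\<phi> z j) = norm (p j z)" by (simp add: \<phi>_def nz)
    ultimately show ?thesis by simp
  qed
  then show ?thesis by (rule Liouville_line_holomorphic[where f = "p j", OF p])
qed

lemma constant_partials_imp_linear_function: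
  fixes u :: "complex ^ 'n \<Rightarrow> complex"
  assumes u: "line_holomorphic u" and c: "\<And>j z. dir_deriv (axis j 1) u z = c $ j"
  shows "linear_function u"
proof -
  define l where "l = (\<lambda>z. \<Sum>j\<in>UNIV. c $ j * z $ j)"
  have line: "l (z + t *s v) = l z + t * l v" for z t v
    by (simp add: l_def algebra_simps sum.distrib sum_distrib_left)
  have hol: "line_holomorphic (\<lambda>z. u z - l z)"
    unfolding line_holomorphic_def
  proof (intro conjI allI)
    show "continuous_on UNIV (\<lambda>z. u z - l z)"
      unfolding l_def by (intro continuous_intros line_holomorphicD(1)[OF u])
    show "(\<lambda>t. u (a + t *s v) - l (a + t *s v)) holomorphic_on UNIV" for a v
      unfolding line by (intro holomorphic_intros line_holomorphicD(2)[OF u])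
  qed
  have "dir_deriv (axis k 1) (\<lambda>z. u z - l z) z = 0" for k z
  proof -
    have "l (axis k 1) = c $ k" by (simp add: l_def axis_def if_distrib cong: if_cong)
    then have "((\<lambda>t. u (z + t *s axis k 1) - l (z + t *s axis k 1)) has_field_derivative 0) (at 0)"
      unfolding line using dir_deriv_DERIV[OF u, of z "axis k 1" 0] c
      by (auto intro!: derivative_eq_intros)
    then show ?thesis unfolding dir_deriv_def by (rule DERIV_imp_deriv)
  qed
  then have const: "u z - l z = u 0 - l 0" for z
    by (rule zero_partial_derivs_imp_constant[OF hol])
  have "l 0 = 0" by (simp add: l_def)
  then have "u z = u 0 + l z" for z using const[of z] by (simp only: diff_eq_eq diff_zero)
  then show ?thesis unfolding linear_function_def l_def by (intro exI allI)
qed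

theorem corollary2:
  fixes u :: "complex ^ 'n \<Rightarrow> complex" and g :: complex
  assumes "entire u"
    and "\<And>z. (\<Prod>j\<in>UNIV. partial_deriv j u z) = exp g"
  shows "linear_function u"
proof -
  have u: "line_holomorphic u" using assms(1) by (rule entire_imp_line_holomorphic)
  have "dir_deriv (axis j 1) u z = (\<chi> j. dir_deriv (axis j 1) u 0) $ j" for j z
    using partials_constant[OF u, of "exp g" j z 0] assms(2)
    by (simp add: partial_deriv_eq_dir_deriv)
  then show ?thesis by (rule constant_partials_imp_linear_function[OF u])
qed

end
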